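(* Let $(H,\langle\cdot,\cdot\rangle_H)$ be a Hilbert space and let $(E,\|\cdot\|_E)$ be a Banach space. Suppose that $F\colon[0,+\infty)\to[0,+\infty)$ is a map with $F(0)=0$ such that the function $t\mapsto F(\sqrt{t})$ on $[0,+\infty)$ is strictly increasing and concave. If $X\subset F[H]$ is a finite subset, $S\subset X$ is a non-empty subset, and $f\colon S\to E$ is a map, then there is a Lipschitz extension $\overline{f}\colon X\to\overline{\operatorname{conv}}(f(S))$ of $f$ such that $$\operatorname{Lip}(\overline{f})\leq\sup_{x>0}\frac{F(\sqrt{m+1}\,x)}{F(x)}\;\operatorname{Lip}(f),$$ where $m:=|X\setminus S|$.
   Context: $F[H]$ (the $F$-transform of $H$) denotes the set $H$ equipped with the function $\rho(x,x'):=F(\|x-x'\|_H)$. Lipschitz constants of maps defined on subsets of $F[H]$ are taken with respect to $\rho$: for $A\subset F[H]$ and $g\colon A\to E$, $$\operatorname{Lip}(g):=\inf\{L\geq 0:\ \|g(x)-g(x')\|_E\leq L\,F(\|x-x'\|_H)\text{ for all }x,x'\in A\},$$ and $g$ is Lipschitz if $\operatorname{Lip}(g)<\infty$. $\overline{\operatorname{conv}}$ denotes the closed convex hull and $|\cdot|$ the cardinality. *)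

theory Defs
  imports "HOL-Analysis.Analysis"
begin

definition F_transform_dist :: "(real \<Rightarrow> real) \<Rightarrow> 'h::real_normed_vector \<Rightarrow> 'h \<Rightarrow> real"
  where "F_transform_dist F x x' = F (norm (x - x'))"

text \<open>
  The constant is taken in \<open>ennreal\<close>, so that the infimum over an empty set of
  admissible constants is \<open>\<infinity>\<close>.  The argument \<open>\<rho>\<close> is not required to be a metric.
\<close>

definition Lip :: "('a \<Rightarrow> 'a \<Rightarrow> real) \<Rightarrow> 'a set \<Rightarrow> ('a \<Rightarrow> 'e::real_normed_vector) \<Rightarrow> ennreal"
  where "Lip \<rho> A g =
    Inf {ennreal L | L. 0 \<le> L \<and> (\<forall>x\<in>A. \<forall>x'\<in>A. norm (g x - g x') \<le> L * \<rho> x x')}"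

definition is_Lipschitz :: "('a \<Rightarrow> 'a \<Rightarrow> real) \<Rightarrow> 'a set \<Rightarrow> ('a \<Rightarrow> 'e::real_normed_vector) \<Rightarrow> bool"
  where "is_Lipschitz \<rho> A g \<longleftrightarrow> Lip \<rho> A g < \<infinity>"

end

theory Submission
  imports Defs
begin

text \<open>
  Write \<open>m\<close> for the number of points to be added. The extension comes from a random
  retraction: a finitely supported probability distribution on the maps \<open>r\<close> from \<open>X\<close> to \<open>S\<close>
  fixing \<open>S\<close> pointwise, such that \<open>E |r x - r y|\<^sup>2 \<le> (m + 1) |x - y|\<^sup>2\<close> for all \<open>x\<close> and \<open>y\<close> in
  \<open>X\<close> (lemma \<open>random_retraction\<close>). Put \<open>f' x = E (f (r x))\<close>, a convex combination of values of
  \<open>f\<close>. If \<open>L\<close> is the Lipschitz constant of \<open>f\<close>, then \<open>|f' x - f' y| \<le> L E (F |r x - r y|)\<close>, and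
  since \<open>F\<close> is a concave increasing function of the square of the distance, Jensen's inequality
  bounds this by \<open>L F (sqrt (m + 1) |x - y|)\<close>.

  The random retraction has to satisfy finitely many inequalities, linear in its distribution.
  By a theorem of the alternative (\<open>nonpositive_vector_or_positive_weights\<close>) it exists unless
  there are positive weights \<open>c\<close> on the pairs of points for which every single retraction has
  \<open>\<Sum> c |r x - r y|\<^sup>2 > (m + 1) \<Sum> c |x - y|\<^sup>2\<close>. So it suffices to find, for given weights, one
  retraction that increases the weighted energy at most by the factor \<open>m + 1\<close>
  (\<open>retraction_energy_bound\<close>).

  Regard the weights as conductances of an electrical network with boundary \<open>S\<close>. Collapse one edge
  at a time: move the free points so that the two ends of an edge meet, identify them, and continue
  with one free vertex fewer. If an edge \<open>e\<close> with effective resistance \<open>R\<^sub>e\<close> carries the difference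
  vector \<open>d\<^sub>e\<close>, then collapsing it costs the additional energy \<open>|d\<^sub>e|\<^sup>2 / R\<^sub>e\<close> when the points are in
  equilibrium. Foster's theorem says \<open>\<Sum> c\<^sub>e R\<^sub>e = m\<close>; so if \<open>e\<close> is chosen with probability
  \<open>c\<^sub>e R\<^sub>e / m\<close>, the expected additional energy is at most \<open>\<Sum> c\<^sub>e |d\<^sub>e|\<^sup>2 / m\<close>, a fraction \<open>1/m\<close> of the
  energy, and points out of equilibrium only do better on average. Hence some edge collapses at the cost of a factor \<open>(m + 1) / m\<close>
  (\<open>exists_cheap_edge_collapse\<close>), and the factors of the \<open>m\<close> collapses telescope to \<open>m + 1\<close>.
\<close>

section \<open>A theorem of the alternative\<close>

lemma exists_between_finite:
  fixes A B :: "real set"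
  assumes "finite A" "finite B" "\<And>a b. a \<in> A \<Longrightarrow> b \<in> B \<Longrightarrow> a < b"
  shows "\<exists>t. (\<forall>a\<in>A. a < t) \<and> (\<forall>b\<in>B. t < b)"
proof (cases "A = {} \<or> B = {}")
  case True
  then show ?thesis
  proof
    assume "A = {}"
    moreover obtain t where "\<forall>b\<in>B. t < b"
      using \<open>finite B\<close> by (metis Min_le less_le_trans lt_ex)
    ultimately show ?thesis by auto
  next
    assume "B = {}"
    moreover obtain t where "\<forall>a\<in>A. a < t"
      using \<open>finite A\<close> by (metis Max_ge le_less_trans gt_ex)
    ultimately show ?thesis by auto
  qed
next
  case False
  then have "Max A < Min B" using assms by simp
  then obtain t where "Max A < t" "t < Min B" using dense by blast
  then show ?thesis using assms False by (metis Max_ge Min_le le_less_trans less_le_trans)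
qed

text \<open>
  The set \<open>C\<close> stands for a convex cone containing the finitely many vectors \<open>A\<close>. Finiteness of
  \<open>A\<close> is what makes all the weights and all the inequalities strict. The proof is Fourier-Motzkin
  elimination of one coordinate: keep the vectors that are already nonpositive there, and let each
  of them cancel that coordinate of each remaining vector. These combinations stay in the
  smaller cone \<open>C'\<close> of vectors that are nonpositive at the eliminated coordinate, and weights that
  are good for all of them leave room for a weight of the eliminated coordinate. Keeping \<open>C\<close>
  arbitrary makes the induction work.
\<close>

lemma nonpositive_vector_or_positive_weights:
  fixes A C :: "('k \<Rightarrow> real) set"
  assumes "finite K" "finite A" "A \<noteq> {}" "A \<subseteq> C"
    and cone: "\<And>u v s t. u \<in> C \<Longrightarrow> v \<in> C \<Longrightarrow> s \<ge> 0 \<Longrightarrow> t > 0 \<Longrightarrow> (\<lambda>k. s * u k + t * v k) \<in> C"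
  shows "(\<exists>v\<in>C. \<forall>k\<in>K. v k \<le> 0) \<or>
    (\<exists>w. (\<forall>k\<in>K. w k > 0) \<and> (\<forall>v\<in>A. (\<Sum>k\<in>K. w k * v k) > 0))"
  using assms
proof (induction K arbitrary: A C rule: finite_induct)
  case empty
  then show ?case by auto
next
  case (insert k0 K)
  define N where "N = {v \<in> A. v k0 \<le> 0}"
  define P where "P = {v \<in> A. v k0 > 0}"
  define mix where "mix = (\<lambda>(u, v) k. (- u k0) * v k + v k0 * u k :: real)"
  define A' where "A' = N \<union> mix ` (N \<times> P)"
  define C' where "C' = {v \<in> C. v k0 \<le> 0}"
  have fin: "finite N" "finite P" using insert.prems by (auto simp: N_def P_def)
  show ?case
  proof (cases "N = {}")
    case True
    \<comment> \<open>Then \<open>A'\<close> is empty and the induction hypothesis does not apply, but a heavy weight on \<open>k0\<close> wins.\<close>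
    have pos: "v k0 > 0" if "v \<in> A" for v using True that by (force simp: N_def)
    obtain t where t: "\<forall>a\<in>insert 0 ((\<lambda>v. - (\<Sum>k\<in>K. v k) / v k0) ` A). a < t"
      using exists_between_finite[of "insert 0 ((\<lambda>v. - (\<Sum>k\<in>K. v k) / v k0) ` A)" "{}"]
        insert.prems by auto
    define w where "w = (\<lambda>k. if k = k0 then t else 1)"
    have "(\<Sum>k\<in>insert k0 K. w k * v k) > 0" if "v \<in> A" for v
    proof -
      have "- (\<Sum>k\<in>K. v k) / v k0 < t" using t that by auto
      then have "0 < t * v k0 + (\<Sum>k\<in>K. v k)" using pos[OF that] by (simp add: field_simps)
      also have "\<dots> = (\<Sum>k\<in>insert k0 K. w k * v k)"
        using insert.hyps by (auto simp: w_def intro!: sum.cong)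
      finally show ?thesis .
    qed
    moreover have "\<forall>k\<in>insert k0 K. w k > 0" using t by (auto simp: w_def)
    ultimately show ?thesis by blast
  next
    case False
    have "finite A'" "A' \<noteq> {}" using fin False by (auto simp: A'_def)
    moreover have "A' \<subseteq> C'"
    proof -
      have "mix (u, v) \<in> C'" if "u \<in> N" "v \<in> P" for u v
        using insert.prems(4)[of v u "- u k0" "v k0"] insert.prems(3) that
        by (auto simp: C'_def N_def P_def mix_def)
      then show ?thesis using insert.prems(3) by (auto simp: A'_def C'_def N_def)
    qed
    moreover have "(\<lambda>k. s * u k + t * v k) \<in> C'" if "u \<in> C'" "v \<in> C'" "s \<ge> 0" "t > 0" for u v s t
      using that insert.prems(4) by (auto simp: C'_def intro!: add_nonpos_nonpos mult_nonneg_nonpos)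
    ultimately consider (vec) "\<exists>v\<in>C'. \<forall>k\<in>K. v k \<le> 0"
      | (wt) "\<exists>w. (\<forall>k\<in>K. w k > 0) \<and> (\<forall>v\<in>A'. (\<Sum>k\<in>K. w k * v k) > 0)"
      using insert.IH[of A' C'] by blast
    then show ?thesis
    proof cases
      case vec
      then show ?thesis by (auto simp: C'_def)
    next
      case wt
      then obtain w where w: "\<forall>k\<in>K. w k > 0" "\<forall>v\<in>A'. (\<Sum>k\<in>K. w k * v k) > 0" by blast
      define W where "W = (\<lambda>v :: 'k \<Rightarrow> real. \<Sum>k\<in>K. w k * v k)"
      have WN: "W u > 0" if "u \<in> N" for u using w that by (auto simp: W_def A'_def)
      have Wmix: "(- u k0) * W v + v k0 * W u > 0" if "u \<in> N" "v \<in> P" for u v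
      proof -
        have "W (mix (u, v)) > 0" using w that by (auto simp: W_def A'_def)
        also have "W (mix (u, v)) = (- u k0) * W v + v k0 * W u"
          by (simp add: W_def mix_def sum_distrib_left sum.distrib[symmetric] algebra_simps)
        finally show ?thesis .
      qed
      \<comment> \<open>Weight \<open>t\<close> at \<open>k0\<close> is good exactly if \<open>t\<close> lies above all of \<open>lo\<close> and below all of \<open>up\<close>;
        the mixed vectors say that \<open>lo\<close> lies below \<open>up\<close>. The element 0 of \<open>lo\<close> makes \<open>t\<close> positive.\<close>
      define lo where "lo = insert 0 ((\<lambda>v. - W v / v k0) ` P)"
      define up where "up = (\<lambda>u. W u / (- u k0)) ` {u \<in> N. u k0 < 0}"
      have "x < y" if "x \<in> lo" "y \<in> up" for x y
        using that WN Wmix by (fastforce simp: lo_def up_def P_def field_simps)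
      then obtain t where t: "\<forall>x\<in>lo. x < t" "\<forall>y\<in>up. t < y"
        using exists_between_finite[of lo up] fin by (auto simp: lo_def up_def)
      have "t > 0" using t by (auto simp: lo_def)
      define w' where "w' = w(k0 := t)"
      have "(\<Sum>k\<in>insert k0 K. w' k * v k) > 0" if "v \<in> A" for v
      proof -
        have "(\<Sum>k\<in>insert k0 K. w' k * v k) = t * v k0 + W v"
          using insert.hyps by (auto simp: w'_def W_def intro!: sum.cong)
        also have "\<dots> > 0"
        proof (cases "v k0 > 0")
          case True
          then have "- W v / v k0 < t" using t that by (auto simp: lo_def P_def)
          then show ?thesis using True by (simp add: field_simps)
        next
          case f: False
          then have "v \<in> N" using that by (auto simp: N_def)
          show ?thesis
          proof (cases "v k0 = 0")
            case True then show ?thesis using WN[OF \<open>v \<in> N\<close>] by simp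
          next
            case False
            then have "v k0 < 0" using f by simp
            then have "t < W v / (- v k0)" using t \<open>v \<in> N\<close> by (auto simp: up_def)
            then show ?thesis using \<open>v k0 < 0\<close> by (simp add: field_simps)
          qed
        qed
        finally show ?thesis .
      qed
      moreover have "\<forall>k\<in>insert k0 K. w' k > 0" using w \<open>t > 0\<close> by (auto simp: w'_def)
      ultimately show ?thesis by blast
    qed
  qed
qed

section \<open>The Dirichlet form of a network with grounded boundary\<close>

text \<open>
  Networks are multigraphs: \<open>K\<close> is a set of edge names, and the edge \<open>k\<close> joins \<open>a k\<close> to \<open>b k\<close> with
  conductance \<open>c k\<close>. Identifying two vertices then changes only \<open>a\<close> and \<open>b\<close>, and loops and
  parallel edges created by it do no harm.
\<close>

definition dirichlet :: "'k set \<Rightarrow> ('k \<Rightarrow> real) \<Rightarrow> ('k \<Rightarrow> 'v) \<Rightarrow> ('k \<Rightarrow> 'v) \<Rightarrow> ('v \<Rightarrow> real) \<Rightarrow> ('v \<Rightarrow> real) \<Rightarrow> real"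
  where "dirichlet K c a b g h = (\<Sum>k\<in>K. c k * ((g (a k) - g (b k)) * (h (a k) - h (b k))))"

lemma dirichlet_commute: "dirichlet K c a b g h = dirichlet K c a b h g"
  by (simp add: dirichlet_def mult.commute)

lemma dirichlet_diff_left:
  "dirichlet K c a b (\<lambda>x. g x - g' x) h = dirichlet K c a b g h - dirichlet K c a b g' h"
  by (simp add: dirichlet_def sum_subtractf[symmetric] algebra_simps)

lemma dirichlet_scale_left:
  "dirichlet K c a b (\<lambda>x. s * g x) h = s * dirichlet K c a b g h"
  by (simp add: dirichlet_def sum_distrib_left algebra_simps)

lemma dirichlet_sum_left:
  "dirichlet K c a b (\<lambda>x. \<Sum>j\<in>J. s j * g j x) h = (\<Sum>j\<in>J. s j * dirichlet K c a b (g j) h)"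
proof -
  have "dirichlet K c a b (\<lambda>x. \<Sum>j\<in>J. s j * g j x) h
    = (\<Sum>k\<in>K. \<Sum>j\<in>J. s j * (c k * ((g j (a k) - g j (b k)) * (h (a k) - h (b k)))))"
    unfolding dirichlet_def
    by (simp add: sum_subtractf[symmetric] sum_distrib_left sum_distrib_right algebra_simps)
  also have "\<dots> = (\<Sum>j\<in>J. s j * dirichlet K c a b (g j) h)"
    by (subst sum.swap) (simp add: dirichlet_def sum_distrib_left)
  finally show ?thesis .
qed

text \<open>
  The set \<open>I\<close> consists of the free vertices. An edge of positive conductance from each of them
  directly to the boundary is a simple substitute for connectedness, and it survives
  identifying a free vertex with another vertex.
\<close>

lemma dirichlet_pos:
  assumes "finite K" "\<And>k. k \<in> K \<Longrightarrow> c k \<ge> 0"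
    and "\<And>x. x \<in> I \<Longrightarrow> \<exists>k\<in>K. c k > 0 \<and> a k = x \<and> b k \<notin> I"
    and "\<And>x. x \<notin> I \<Longrightarrow> h x = 0" and "h y \<noteq> 0"
  shows "dirichlet K c a b h h > 0"
proof -
  have "y \<in> I" using assms(4,5) by blast
  then obtain k where k: "k \<in> K" "c k > 0" "a k = y" "b k \<notin> I" using assms(3) by blast
  then have "c k * ((h (a k) - h (b k)) * (h (a k) - h (b k))) > 0"
    using assms(4)[of "b k"] assms(5) by (auto intro!: mult_pos_pos simp: zero_less_mult_iff)
  then show ?thesis
    unfolding dirichlet_def using k assms(1,2)
    by (intro sum_pos2[of K k]) (auto intro!: mult_nonneg_nonneg)
qed

text \<open>
  Gram-Schmidt orthonormalisation of the indicator functions of the free vertices. The index set of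
  the basis is \<open>I\<close> itself, so that its cardinality is known.
\<close>

lemma dirichlet_orthonormal:
  assumes "finite I"
    and "\<And>h y. (\<And>x. x \<notin> I \<Longrightarrow> h x = 0) \<Longrightarrow> h y \<noteq> 0 \<Longrightarrow> dirichlet K c a b h h > 0"
  shows "\<exists>g. (\<forall>i\<in>I. \<forall>x. x \<notin> I \<longrightarrow> g i x = 0) \<and>
    (\<forall>i\<in>I. \<forall>j\<in>I. dirichlet K c a b (g i) (g j) = of_bool (i = j))"
  using assms
proof (induction I rule: finite_induct)
  case empty
  then show ?case by auto
next
  case (insert v I)
  let ?D = "dirichlet K c a b"
  obtain g where supp: "\<forall>i\<in>I. \<forall>x. x \<notin> I \<longrightarrow> g i x = 0"
    and on: "\<forall>i\<in>I. \<forall>j\<in>I. ?D (g i) (g j) = of_bool (i = j)"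
    using insert.IH insert.prems by (metis insertCI)
  define u where "u = (\<lambda>x. of_bool (x = v) :: real)"
  define h where "h = (\<lambda>x. u x - (\<Sum>i\<in>I. ?D u (g i) * g i x))"
  have orth: "?D h (g j) = 0" if "j \<in> I" for j
  proof -
    have "?D h (g j) = ?D u (g j) - (\<Sum>i\<in>I. ?D u (g i) * ?D (g i) (g j))"
      unfolding h_def by (simp add: dirichlet_diff_left dirichlet_sum_left)
    also have "(\<Sum>i\<in>I. ?D u (g i) * ?D (g i) (g j)) = (\<Sum>i\<in>I. if i = j then ?D u (g j) else 0)"
      using on that by (intro sum.cong) auto
    finally show ?thesis using that insert.hyps by simp
  qed
  have hsupp: "h x = 0" if "x \<notin> insert v I" for x
    using that supp by (auto simp: h_def u_def)
  have "h v = 1" using supp insert.hyps by (simp add: h_def u_def)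
  then have hpos: "?D h h > 0" using insert.prems[of h v] hsupp by force
  define n where "n = 1 / sqrt (?D h h)"
  define g' where "g' = g(v := (\<lambda>x. n * h x))"
  have scale_right: "?D g1 (\<lambda>x. n * h x) = n * ?D g1 h" for g1
    by (simp only: dirichlet_commute[of K c a b g1] dirichlet_scale_left)
  have "?D (g' v) (g' v) = n\<^sup>2 * ?D h h"
    by (simp add: g'_def dirichlet_scale_left scale_right power2_eq_square)
  also have "\<dots> = 1" using hpos by (simp add: n_def power_divide)
  finally have vv: "?D (g' v) (g' v) = 1" .
  have vj: "?D (g' v) (g' j) = 0" "?D (g' j) (g' v) = 0" if "j \<in> I" for j
    using that insert.hyps orth[OF that] dirichlet_commute[of K c a b "g j" h]
    by (auto simp: g'_def dirichlet_scale_left scale_right)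
  have "\<forall>i\<in>insert v I. \<forall>j\<in>insert v I. ?D (g' i) (g' j) = of_bool (i = j)"
  proof (intro ballI)
    fix i j assume ij: "i \<in> insert v I" "j \<in> insert v I"
    consider "i = v" "j = v" | "i = v" "j \<in> I" | "i \<in> I" "j = v" | "i \<in> I" "j \<in> I"
      using ij by blast
    then show "?D (g' i) (g' j) = of_bool (i = j)"
    proof cases
      case 4
      then have "g' i = g i" "g' j = g j" using insert.hyps by (auto simp: g'_def)
      then show ?thesis using on 4 by simp
    qed (use vv vj insert.hyps in auto)
  qed
  moreover have "\<forall>i\<in>insert v I. \<forall>x. x \<notin> insert v I \<longrightarrow> g' i x = 0"
    using supp hsupp by (auto simp: g'_def)
  ultimately show ?case by blast
qed

section \<open>Collapsing edges\<close>

text \<open>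
  Here \<open>\<delta> j k\<close> is the difference of the \<open>j\<close>-th orthonormal function along the edge \<open>k\<close>, so that
  \<open>R\<close> is the kernel of the orthogonal projection onto the differences of functions supported on the
  free vertices, and \<open>R e e\<close> is the effective resistance of \<open>e\<close>. Subtracting the stated multiple of
  \<open>d e\<close> is the smallest correction by such functions that makes the difference along \<open>e\<close> vanish.

  Averaging the new energies with weights \<open>c e * R e e\<close>, which add up to the number of orthonormal
  functions, gives the bound. The cross terms add up to \<open>- 2 * (\<Sum>j\<in>J. P j \<bullet> P j)\<close>, where \<open>P j\<close> are the
  coefficients of \<open>d\<close> in the orthonormal family; they vanish in equilibrium and help otherwise.
\<close>

lemma exists_cheap_edge_collapse:
  fixes \<delta> :: "'j \<Rightarrow> 'k \<Rightarrow> real" and d :: "'k \<Rightarrow> 'h::real_inner"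
  assumes "finite K" "finite J" "J \<noteq> {}" and c: "\<And>k. k \<in> K \<Longrightarrow> c k \<ge> 0"
    and on: "\<And>i j. i \<in> J \<Longrightarrow> j \<in> J \<Longrightarrow> (\<Sum>k\<in>K. c k * (\<delta> i k * \<delta> j k)) = of_bool (i = j)"
  defines "R \<equiv> \<lambda>e k. \<Sum>j\<in>J. \<delta> j e * \<delta> j k"
  shows "\<exists>e\<in>K. R e e > 0 \<and>
    (\<Sum>k\<in>K. c k * (norm (d k - (R e k / R e e) *\<^sub>R d e))\<^sup>2)
      \<le> (1 + 1 / card J) * (\<Sum>k\<in>K. c k * (norm (d k))\<^sup>2)"
proof (rule ccontr)
  assume neg: "\<not> ?thesis"
  define En where "En = (\<Sum>k\<in>K. c k * (norm (d k))\<^sup>2)"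
  define En' where "En' = (\<lambda>e. \<Sum>k\<in>K. c k * (norm (d k - (R e k / R e e) *\<^sub>R d e))\<^sup>2)"
  define P where "P = (\<lambda>j. \<Sum>k\<in>K. (c k * \<delta> j k) *\<^sub>R d k)"
  have Rnn: "R e e \<ge> 0" for e by (auto simp: R_def intro!: sum_nonneg)
  have RR: "(\<Sum>k\<in>K. c k * (R e k)\<^sup>2) = R e e" for e
  proof -
    have "(\<Sum>k\<in>K. c k * (R e k)\<^sup>2)
        = (\<Sum>k\<in>K. \<Sum>i\<in>J. \<Sum>j\<in>J. \<delta> i e * \<delta> j e * (c k * (\<delta> i k * \<delta> j k)))"
      by (simp add: R_def power2_eq_square sum_product sum_distrib_left mult_ac)
    also have "\<dots> = (\<Sum>i\<in>J. \<Sum>j\<in>J. \<delta> i e * \<delta> j e * (\<Sum>k\<in>K. c k * (\<delta> i k * \<delta> j k)))"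
      by (subst sum.swap, intro sum.cong refl, subst sum.swap) (simp add: sum_distrib_left)
    also have "\<dots> = (\<Sum>i\<in>J. \<Sum>j\<in>J. if i = j then \<delta> i e * \<delta> i e else 0)"
      by (intro sum.cong refl) (auto simp: on)
    also have "\<dots> = R e e" using \<open>finite J\<close> by (simp add: R_def)
    finally show ?thesis .
  qed
  have RP: "(\<Sum>k\<in>K. (c k * R e k) *\<^sub>R d k) = (\<Sum>j\<in>J. \<delta> j e *\<^sub>R P j)" for e
    unfolding R_def P_def
    by (subst scaleR_sum_right, subst sum.swap)
      (simp add: sum_distrib_left scaleR_sum_left mult_ac)
  \<comment> \<open>Multiplied by \<open>R e e\<close>, the estimate also covers edges with \<open>R e e = 0\<close>, which cannot be collapsed
    and get weight 0 in the average.\<close>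
  have one: "R e e * En' e \<le> R e e * En - 2 * (\<Sum>j\<in>J. \<delta> j e * (P j \<bullet> d e)) + (norm (d e))\<^sup>2" for e
  proof (cases "R e e = 0")
    case True
    then have "\<forall>j\<in>J. \<delta> j e = 0"
      using \<open>finite J\<close> by (simp add: R_def sum_nonneg_eq_0_iff)
    then show ?thesis using True by simp
  next
    case False
    then have pos: "R e e > 0" using Rnn[of e] by linarith
    have expand: "(norm (d k - s *\<^sub>R d e))\<^sup>2
        = (norm (d k))\<^sup>2 - 2 * s * (d k \<bullet> d e) + (norm (d e))\<^sup>2 * s\<^sup>2" for k s
      unfolding power2_norm_eq_inner
      by (simp add: inner_diff_left inner_diff_right inner_commute power2_eq_square algebra_simps)
    have "En' e = (\<Sum>k\<in>K. c k * (norm (d k))\<^sup>2 - 2 / R e e * ((c k * R e k) *\<^sub>R d k \<bullet> d e)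
        + (norm (d e))\<^sup>2 / (R e e)\<^sup>2 * (c k * (R e k)\<^sup>2))"
      unfolding En'_def expand
      by (intro sum.cong refl) (simp add: power_divide algebra_simps)
    also have "\<dots> = En - 2 / R e e * ((\<Sum>k\<in>K. (c k * R e k) *\<^sub>R d k) \<bullet> d e)
        + (norm (d e))\<^sup>2 / (R e e)\<^sup>2 * (\<Sum>k\<in>K. c k * (R e k)\<^sup>2)"
      by (simp only: sum.distrib sum_subtractf En_def inner_sum_left sum_distrib_left)
    also have "\<dots> = En - 2 / R e e * (\<Sum>j\<in>J. \<delta> j e * (P j \<bullet> d e)) + (norm (d e))\<^sup>2 / R e e"
      using pos unfolding RR RP by (simp add: inner_sum_left power2_eq_square)
    finally show ?thesis using pos by (simp add: field_simps)
  qed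
  \<comment> \<open>Foster's theorem: exchanging the sums gives the trace of the identity.\<close>
  have foster: "(\<Sum>e\<in>K. c e * R e e) = card J"
  proof -
    have "(\<Sum>e\<in>K. c e * R e e) = (\<Sum>j\<in>J. \<Sum>e\<in>K. c e * (\<delta> j e * \<delta> j e))"
      by (subst sum.swap) (simp add: R_def sum_distrib_left)
    then show ?thesis by (simp add: on)
  qed
  have PP: "(\<Sum>e\<in>K. c e * (\<Sum>j\<in>J. \<delta> j e * (P j \<bullet> d e))) = (\<Sum>j\<in>J. P j \<bullet> P j)"
  proof -
    have Pj: "(\<Sum>e\<in>K. (c e * \<delta> j e) *\<^sub>R d e) = P j" for j by (simp add: P_def)
    have "(\<Sum>e\<in>K. c e * (\<Sum>j\<in>J. \<delta> j e * (P j \<bullet> d e)))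
        = (\<Sum>j\<in>J. \<Sum>e\<in>K. P j \<bullet> ((c e * \<delta> j e) *\<^sub>R d e))"
      by (subst sum.swap) (simp add: sum_distrib_left mult_ac)
    also have "(\<Sum>j\<in>J. \<Sum>e\<in>K. P j \<bullet> ((c e * \<delta> j e) *\<^sub>R d e)) = (\<Sum>j\<in>J. P j \<bullet> P j)"
      by (simp only: inner_sum_right[symmetric] Pj)
    finally show ?thesis .
  qed
  have m: "real (card J) > 0" using assms by (simp add: card_gt_0_iff)
  have "(\<Sum>e\<in>K. c e * (R e e * En' e))
      \<le> (\<Sum>e\<in>K. c e * (R e e * En - 2 * (\<Sum>j\<in>J. \<delta> j e * (P j \<bullet> d e)) + (norm (d e))\<^sup>2))"
    by (intro sum_mono mult_left_mono one c)
  also have "\<dots> = (\<Sum>e\<in>K. c e * R e e) * En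
      - 2 * (\<Sum>e\<in>K. c e * (\<Sum>j\<in>J. \<delta> j e * (P j \<bullet> d e))) + En"
  proof -
    have "c e * (R e e * En - 2 * T + n) = c e * R e e * En - 2 * (c e * T) + c e * n" for e T n
      by (simp add: algebra_simps)
    then show ?thesis
      unfolding sum_distrib_left[of 2 _ K] sum_distrib_right[of _ K En]
      by (simp only: sum.distrib sum_subtractf En_def[symmetric])
  qed
  also have "\<dots> \<le> (card J + 1) * En"
    unfolding foster PP by (simp add: sum_nonneg algebra_simps)
  finally have upper: "(\<Sum>e\<in>K. c e * (R e e * En' e)) \<le> (card J + 1) * En" .
  have gt: "En' e > (1 + 1 / card J) * En" if "e \<in> K" "R e e > 0" for e
    using neg that unfolding En_def En'_def by force
  have "(card J + 1) * En = (\<Sum>e\<in>K. c e * R e e * ((1 + 1 / card J) * En))"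
    unfolding sum_distrib_right[symmetric] foster using m by (simp add: field_simps)
  also have "\<dots> < (\<Sum>e\<in>K. c e * R e e * En' e)"
  proof (rule sum_strict_mono_ex1)
    show "\<forall>e\<in>K. c e * R e e * ((1 + 1 / card J) * En) \<le> c e * R e e * En' e"
    proof
      fix e assume "e \<in> K"
      then show "c e * R e e * ((1 + 1 / card J) * En) \<le> c e * R e e * En' e"
        using gt[of e] Rnn[of e] c[of e] by (cases "R e e = 0") (auto intro!: mult_left_mono)
    qed
    have "(\<Sum>e\<in>K. c e * R e e) \<noteq> 0" using foster m by simp
    then obtain e where e: "e \<in> K" "c e * R e e \<noteq> 0" using sum.not_neutral_contains_not_neutral by blast
    then have "c e * R e e > 0" "R e e > 0" using c[of e] Rnn[of e] by (auto simp: less_le)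
    then show "\<exists>e\<in>K. c e * R e e * ((1 + 1 / card J) * En) < c e * R e e * En' e"
      using gt[of e] e by (intro bexI[of _ e] mult_strict_left_mono) auto
  qed fact
  finally show False using upper by (simp add: mult_ac)
qed

text \<open>
  The energy is bounded for the positions \<open>\<phi>\<close> given at the start; only the boundary positions
  persist, as each collapse moves the free points to new positions \<open>\<psi>\<close>. Identifying the ends of the
  collapsed edge does not change the energy of \<open>\<psi>\<close>, and the retraction of the smaller network,
  composed with the identification, takes values in \<open>S\<close>, where \<open>\<psi>\<close> and \<open>\<phi>\<close> agree.
\<close>

lemma retraction_energy_bound:
  fixes \<phi> :: "'v \<Rightarrow> 'h::real_inner"
  assumes "finite I" "finite K" "I \<inter> S = {}"
    and "\<And>k. k \<in> K \<Longrightarrow> c k \<ge> 0"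
    and "\<And>k. k \<in> K \<Longrightarrow> a k \<in> I \<union> S" "\<And>k. k \<in> K \<Longrightarrow> b k \<in> I \<union> S"
    and "\<And>x. x \<in> I \<Longrightarrow> \<exists>k\<in>K. c k > 0 \<and> a k = x \<and> b k \<in> S"
  shows "\<exists>r. (\<forall>x\<in>I. r x \<in> S) \<and> (\<forall>x\<in>S. r x = x) \<and>
    (\<Sum>k\<in>K. c k * (norm (\<phi> (r (a k)) - \<phi> (r (b k))))\<^sup>2)
      \<le> (card I + 1) * (\<Sum>k\<in>K. c k * (norm (\<phi> (a k) - \<phi> (b k)))\<^sup>2)"
  using assms
proof (induction "card I" arbitrary: I a b \<phi>)
  case 0
  then have "I = {}" by simp
  then show ?case using 0 by (intro exI[of _ id]) auto
next
  case (Suc m)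
  note prems = Suc.prems
  have "\<exists>g. (\<forall>i\<in>I. \<forall>x. x \<notin> I \<longrightarrow> g i x = 0) \<and>
    (\<forall>i\<in>I. \<forall>j\<in>I. dirichlet K c a b (g i) (g j) = of_bool (i = j))"
  proof (rule dirichlet_orthonormal[OF prems(1)])
    fix h y assume "\<And>x. x \<notin> I \<Longrightarrow> h x = 0" "h y \<noteq> (0::real)"
    moreover have "\<exists>k\<in>K. c k > 0 \<and> a k = x \<and> b k \<notin> I" if "x \<in> I" for x
      using prems(7)[OF that] prems(3) by blast
    ultimately show "dirichlet K c a b h h > 0"
      using dirichlet_pos[of K c I a b h y] prems(2,4) by blast
  qed
  then obtain g where supp: "\<And>i x. i \<in> I \<Longrightarrow> x \<notin> I \<Longrightarrow> g i x = 0"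
    and on: "\<And>i j. i \<in> I \<Longrightarrow> j \<in> I \<Longrightarrow> dirichlet K c a b (g i) (g j) = of_bool (i = j)"
    by blast
  define \<delta> where "\<delta> = (\<lambda>i k. g i (a k) - g i (b k))"
  define R where "R = (\<lambda>e k. \<Sum>j\<in>I. \<delta> j e * \<delta> j k)"
  define d where "d = (\<lambda>k. \<phi> (a k) - \<phi> (b k))"
  have "I \<noteq> {}" using Suc.hyps(2) by auto
  obtain e where e: "e \<in> K" "R e e > 0"
    and le: "(\<Sum>k\<in>K. c k * (norm (d k - (R e k / R e e) *\<^sub>R d e))\<^sup>2)
      \<le> (1 + 1 / card I) * (\<Sum>k\<in>K. c k * (norm (d k))\<^sup>2)"
    using exists_cheap_edge_collapse[of K I c \<delta> d] prems(1,2,4) \<open>I \<noteq> {}\<close> on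
    unfolding R_def \<delta>_def dirichlet_def by blast
  define \<psi> where "\<psi> = (\<lambda>x. \<phi> x - ((\<Sum>j\<in>I. \<delta> j e * g j x) / R e e) *\<^sub>R d e)"
  have d\<psi>: "\<psi> (a k) - \<psi> (b k) = d k - (R e k / R e e) *\<^sub>R d e" for k
  proof -
    have "R e k = (\<Sum>j\<in>I. \<delta> j e * g j (a k)) - (\<Sum>j\<in>I. \<delta> j e * g j (b k))"
      by (simp add: R_def \<delta>_def right_diff_distrib sum_subtractf)
    then show ?thesis by (simp add: \<psi>_def d_def diff_divide_distrib scaleR_diff_left)
  qed
  have \<psi>S: "\<psi> x = \<phi> x" if "x \<in> S" for x
  proof -
    have "x \<notin> I" using that prems(3) by blast
    then have "(\<Sum>j\<in>I. \<delta> j e * g j x) = 0" using supp by (intro sum.neutral) auto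
    then show ?thesis by (simp add: \<psi>_def)
  qed
  have eq: "\<psi> (a e) = \<psi> (b e)" using d\<psi>[of e] e(2) by simp
  have "\<not> (a e \<notin> I \<and> b e \<notin> I)" "a e \<noteq> b e"
  proof -
    have "\<exists>j\<in>I. \<delta> j e \<noteq> 0"
    proof (rule ccontr)
      assume "\<not> ?thesis"
      then have "R e e = 0" unfolding R_def by (intro sum.neutral) auto
      then show False using e(2) by simp
    qed
    then obtain j where "j \<in> I" "g j (a e) \<noteq> g j (b e)" by (auto simp: \<delta>_def)
    then show "\<not> (a e \<notin> I \<and> b e \<notin> I)" "a e \<noteq> b e" by (metis supp)+
  qed
  then obtain v u where vu: "v \<in> I" "u \<in> I \<union> S" "u \<noteq> v" "\<psi> u = \<psi> v"
  proof (cases "a e \<in> I")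
    case True
    then show ?thesis using that[of "a e" "b e"] prems(6)[OF e(1)] eq \<open>a e \<noteq> b e\<close> by simp
  next
    case False
    then show ?thesis
      using that[of "b e" "a e"] prems(5)[OF e(1)] eq \<open>a e \<noteq> b e\<close> \<open>\<not> (a e \<notin> I \<and> b e \<notin> I)\<close> by simp
  qed
  define \<sigma> where "\<sigma> = id(v := u)"
  have \<psi>\<sigma>: "\<psi> (\<sigma> x) = \<psi> x" for x using vu by (simp add: \<sigma>_def)
  have vS: "v \<notin> S" using vu prems(3) by blast
  have "\<exists>r. (\<forall>x\<in>I - {v}. r x \<in> S) \<and> (\<forall>x\<in>S. r x = x) \<and>
    (\<Sum>k\<in>K. c k * (norm (\<psi> (r ((\<sigma> \<circ> a) k)) - \<psi> (r ((\<sigma> \<circ> b) k))))\<^sup>2)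
      \<le> (card (I - {v}) + 1) * (\<Sum>k\<in>K. c k * (norm (\<psi> ((\<sigma> \<circ> a) k) - \<psi> ((\<sigma> \<circ> b) k)))\<^sup>2)"
  proof (rule Suc.hyps(1))
    show "m = card (I - {v})" using Suc.hyps(2) vu(1) prems(1) by simp
    show "\<exists>k\<in>K. c k > 0 \<and> (\<sigma> \<circ> a) k = x \<and> (\<sigma> \<circ> b) k \<in> S" if x: "x \<in> I - {v}" for x
    proof -
      obtain k where "k \<in> K" "c k > 0" "a k = x" "b k \<in> S" using prems(7) x by blast
      then show ?thesis using x vS by (intro bexI[of _ k]) (auto simp: \<sigma>_def)
    qed
    show "(I - {v}) \<inter> S = {}" using prems(3) by blast
    show "(\<sigma> \<circ> a) k \<in> (I - {v}) \<union> S" "(\<sigma> \<circ> b) k \<in> (I - {v}) \<union> S" if "k \<in> K" for k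
      using prems(5,6)[OF that] vu(2,3) by (auto simp: \<sigma>_def)
  qed (use prems(1,2,4) in simp_all)
  then obtain r where r: "\<And>x. x \<in> I - {v} \<Longrightarrow> r x \<in> S" "\<And>x. x \<in> S \<Longrightarrow> r x = x"
    and rle: "(\<Sum>k\<in>K. c k * (norm (\<psi> (r (\<sigma> (a k))) - \<psi> (r (\<sigma> (b k)))))\<^sup>2)
      \<le> (card (I - {v}) + 1) * (\<Sum>k\<in>K. c k * (norm (\<psi> (a k) - \<psi> (b k)))\<^sup>2)"
    unfolding o_def \<psi>\<sigma> by blast
  have rS: "r (\<sigma> x) \<in> S" if "x \<in> I \<union> S" for x
    using that r vu by (cases "x = v") (auto simp: \<sigma>_def)
  have "(\<Sum>k\<in>K. c k * (norm (\<phi> (r (\<sigma> (a k))) - \<phi> (r (\<sigma> (b k)))))\<^sup>2)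
      = (\<Sum>k\<in>K. c k * (norm (\<psi> (r (\<sigma> (a k))) - \<psi> (r (\<sigma> (b k)))))\<^sup>2)"
    using prems(5,6) rS \<psi>S by (intro sum.cong) auto
  also have "\<dots> \<le> card I * (\<Sum>k\<in>K. c k * (norm (\<psi> (a k) - \<psi> (b k)))\<^sup>2)"
    using rle Suc.hyps(2) vu(1) prems(1) by simp
  also have "\<dots> \<le> card I * ((1 + 1 / card I) * (\<Sum>k\<in>K. c k * (norm (d k))\<^sup>2))"
    using le unfolding d\<psi> by (intro mult_left_mono) auto
  also have "\<dots> = (card I + 1) * (\<Sum>k\<in>K. c k * (norm (\<phi> (a k) - \<phi> (b k)))\<^sup>2)"
    using Suc.hyps(2) by (simp add: d_def field_simps)
  finally have "(\<Sum>k\<in>K. c k * (norm (\<phi> (r (\<sigma> (a k))) - \<phi> (r (\<sigma> (b k)))))\<^sup>2)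
      \<le> (card I + 1) * (\<Sum>k\<in>K. c k * (norm (\<phi> (a k) - \<phi> (b k)))\<^sup>2)" .
  moreover have "r (\<sigma> x) = x" if "x \<in> S" for x using that r vS by (auto simp: \<sigma>_def)
  ultimately show ?case using rS by (intro exI[of _ "r \<circ> \<sigma>"]) auto
qed

section \<open>Random retractions and the extension theorem\<close>

text \<open>
  The pure strategies are the retractions in \<open>\<R>\<close>, with payoff vectors \<open>q r\<close> indexed by the pairs of
  points. Weights that are positive on all pairs in particular join each free vertex to \<open>S\<close>, as
  the energy bound requires.
\<close>

lemma random_retraction:
  fixes X S :: "'h::real_inner set"
  assumes "finite X" "S \<subseteq> X" "S \<noteq> {}"
  obtains \<R> and p :: "('h \<Rightarrow> 'h) \<Rightarrow> real"
  where "finite \<R>" "\<And>r. r \<in> \<R> \<Longrightarrow> p r \<ge> 0" "sum p \<R> = 1"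
    "\<And>r x. r \<in> \<R> \<Longrightarrow> x \<in> X \<Longrightarrow> r x \<in> S" "\<And>r x. r \<in> \<R> \<Longrightarrow> x \<in> S \<Longrightarrow> r x = x"
    "\<And>x y. x \<in> X \<Longrightarrow> y \<in> X \<Longrightarrow>
      (\<Sum>r\<in>\<R>. p r * (norm (r x - r y))\<^sup>2) \<le> (real (card (X - S)) + 1) * (norm (x - y))\<^sup>2"
proof -
  define \<R> where "\<R> = {r \<in> X \<rightarrow>\<^sub>E S. \<forall>x\<in>S. r x = x}"
  define M where "M = real (card (X - S)) + 1"
  define q where "q = (\<lambda>(r :: 'h \<Rightarrow> 'h) z. (norm (r (fst z) - r (snd z)))\<^sup>2 - M * (norm (fst z - snd z))\<^sup>2)"
  define C where "C = {\<lambda>z. \<Sum>r\<in>\<R>. p r * q r z | p. (\<forall>r\<in>\<R>. p r \<ge> 0) \<and> sum p \<R> > 0}"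
  have finS: "finite S" using assms finite_subset by blast
  have finR: "finite \<R>" using finite_PiE[OF assms(1), of "\<lambda>_. S"] finS by (auto simp: \<R>_def)
  obtain s0 where s0: "s0 \<in> S" using assms by blast
  have "(\<lambda>x\<in>X. if x \<in> S then x else s0) \<in> \<R>" using s0 assms(2) by (auto simp: \<R>_def)
  then have R_ne: "\<R> \<noteq> {}" by blast
  have "(\<exists>v\<in>C. \<forall>z\<in>X \<times> X. v z \<le> 0) \<or>
    (\<exists>w. (\<forall>z\<in>X \<times> X. w z > 0) \<and> (\<forall>v\<in>q ` \<R>. (\<Sum>z\<in>X \<times> X. w z * v z) > 0))"
  proof (rule nonpositive_vector_or_positive_weights)
    show "q ` \<R> \<subseteq> C"
    proof
      fix v assume "v \<in> q ` \<R>"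
      then obtain r0 where r0: "r0 \<in> \<R>" "v = q r0" by blast
      define p where "p = (\<lambda>r. of_bool (r = r0) :: real)"
      have "v = (\<lambda>z. \<Sum>r\<in>\<R>. p r * q r z)" using r0 finR by (simp add: p_def)
      moreover have "sum p \<R> = 1" using r0 finR by (simp add: p_def)
      ultimately show "v \<in> C" unfolding C_def by (intro CollectI exI[of _ p]) (auto simp: p_def)
    qed
    fix u v and s t :: real assume u: "u \<in> C" and v: "v \<in> C" and st: "s \<ge> 0" "t > 0"
    from u obtain p where p: "u = (\<lambda>z. \<Sum>r\<in>\<R>. p r * q r z)" "\<forall>r\<in>\<R>. p r \<ge> 0" "sum p \<R> > 0"
      unfolding C_def by blast
    from v obtain p' where p': "v = (\<lambda>z. \<Sum>r\<in>\<R>. p' r * q r z)" "\<forall>r\<in>\<R>. p' r \<ge> 0" "sum p' \<R> > 0"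
      unfolding C_def by blast
    have "(\<lambda>z. s * u z + t * v z) = (\<lambda>z. \<Sum>r\<in>\<R>. (s * p r + t * p' r) * q r z)"
      unfolding p p' by (simp add: sum_distrib_left sum.distrib[symmetric] algebra_simps)
    moreover have "(\<Sum>r\<in>\<R>. s * p r + t * p' r) > 0"
      using st p(3) p'(3) by (simp add: sum.distrib sum_distrib_left[symmetric] add_nonneg_pos)
    ultimately show "(\<lambda>z. s * u z + t * v z) \<in> C"
      unfolding C_def using st p(2) p'(2)
      by (intro CollectI exI[of _ "\<lambda>r. s * p r + t * p' r"]) auto
  qed (use assms finR R_ne in auto)
  then show ?thesis
  proof
    assume "\<exists>v\<in>C. \<forall>z\<in>X \<times> X. v z \<le> 0"
    then obtain p where p: "\<forall>r\<in>\<R>. p r \<ge> 0" "sum p \<R> > 0"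
      and le: "\<forall>z\<in>X \<times> X. (\<Sum>r\<in>\<R>. p r * q r z) \<le> 0"
      unfolding C_def by blast
    define p' where "p' = (\<lambda>r. p r / sum p \<R>)"
    have "sum p' \<R> = 1" using p by (simp add: p'_def sum_divide_distrib[symmetric])
    moreover have "(\<Sum>r\<in>\<R>. p' r * (norm (r x - r y))\<^sup>2) \<le> M * (norm (x - y))\<^sup>2" if "x \<in> X" "y \<in> X" for x y
    proof -
      have "(\<Sum>r\<in>\<R>. p r * (norm (r x - r y))\<^sup>2) \<le> sum p \<R> * (M * (norm (x - y))\<^sup>2)"
        using le that by (simp add: q_def right_diff_distrib sum_subtractf sum_distrib_right)
      then show ?thesis using p(2)
        by (simp add: p'_def sum_divide_distrib[symmetric] divide_le_eq mult_ac)
    qed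
    moreover have "p' r \<ge> 0" if "r \<in> \<R>" for r using p that by (simp add: p'_def)
    ultimately show ?thesis using finR unfolding M_def
      by (intro that[of \<R> p']) (auto simp: \<R>_def)
  next
    assume "\<exists>w. (\<forall>z\<in>X \<times> X. w z > 0) \<and> (\<forall>v\<in>q ` \<R>. (\<Sum>z\<in>X \<times> X. w z * v z) > 0)"
    then obtain w where w_all: "\<forall>z\<in>X \<times> X. w z > (0::real)"
      and pos_all: "\<forall>v\<in>q ` \<R>. (\<Sum>z\<in>X \<times> X. w z * v z) > 0" by (elim exE conjE)
    have w: "w z > 0" if "z \<in> X \<times> X" for z using w_all that by (rule bspec)
    have pos: "(\<Sum>z\<in>X \<times> X. w z * q r z) > 0" if "r \<in> \<R>" for r
      using pos_all imageI[OF that] by (rule bspec)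
    have XS: "(X - S) \<union> S = X" using assms(2) by blast
    have "\<exists>r. (\<forall>x\<in>X - S. r x \<in> S) \<and> (\<forall>x\<in>S. r x = x) \<and>
      (\<Sum>z\<in>X \<times> X. w z * (norm (id (r (fst z)) - id (r (snd z))))\<^sup>2)
        \<le> (card (X - S) + 1) * (\<Sum>z\<in>X \<times> X. w z * (norm (id (fst z) - id (snd z)))\<^sup>2)"
    proof (rule retraction_energy_bound[where \<phi> = id and a = fst and b = snd])
      show "\<exists>k\<in>X \<times> X. 0 < w k \<and> fst k = x \<and> snd k \<in> S" if "x \<in> X - S" for x
        using that s0 assms(2) w by (intro bexI[of _ "(x, s0)"]) auto
      show "w z \<ge> 0" if "z \<in> X \<times> X" for z using w[OF that] by (rule less_imp_le)
      show "finite (X - S)" "finite (X \<times> X)" "(X - S) \<inter> S = {}" using assms(1) by auto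
      show "fst z \<in> (X - S) \<union> S" "snd z \<in> (X - S) \<union> S" if "z \<in> X \<times> X" for z
        using that unfolding XS by auto
    qed
    then obtain r where r: "\<And>x. x \<in> X - S \<Longrightarrow> r x \<in> S" "\<And>x. x \<in> S \<Longrightarrow> r x = x"
      and le: "(\<Sum>z\<in>X \<times> X. w z * (norm (r (fst z) - r (snd z)))\<^sup>2)
        \<le> M * (\<Sum>z\<in>X \<times> X. w z * (norm (fst z - snd z))\<^sup>2)"
      unfolding M_def id_apply of_nat_add of_nat_1 by blast
    have "r x \<in> S" if "x \<in> X" for x using r that by (cases "x \<in> S") auto
    then have mem: "restrict r X \<in> \<R>" using r(2) assms(2) by (auto simp: \<R>_def)
    have "(\<Sum>z\<in>X \<times> X. w z * q (restrict r X) z)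
      = (\<Sum>z\<in>X \<times> X. w z * (norm (r (fst z) - r (snd z)))\<^sup>2 - M * (w z * (norm (fst z - snd z))\<^sup>2))"
      by (intro sum.cong refl) (auto simp: q_def algebra_simps)
    also have "\<dots> \<le> 0" using le by (simp add: sum_subtractf sum_distrib_left)
    finally show ?thesis using pos[OF mem] by simp
  qed
qed

text \<open>
  The extension is estimated with an actual Lipschitz constant of \<open>f\<close>, so the infimum has to be a
  minimum.
\<close>

lemma finite_Lip_attained:
  assumes "finite A" and pos: "\<And>x y. x \<in> A \<Longrightarrow> y \<in> A \<Longrightarrow> x \<noteq> y \<Longrightarrow> \<rho> x y > 0"
    and refl: "\<And>x. x \<in> A \<Longrightarrow> \<rho> x x = 0"
  obtains L where "L \<ge> 0" "\<And>x y. x \<in> A \<Longrightarrow> y \<in> A \<Longrightarrow> norm (g x - g y) \<le> L * \<rho> x y"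
    "Lip \<rho> A g = ennreal L"
proof -
  define ratio where "ratio = (\<lambda>(x, y). norm (g x - g y) / \<rho> x y)"
  define L where "L = Max (insert 0 (ratio ` (A \<times> A)))"
  have fin: "finite (insert 0 (ratio ` (A \<times> A)))" using assms(1) by simp
  have "L \<ge> 0" unfolding L_def using fin by (intro Max_ge) auto
  have adm: "norm (g x - g y) \<le> L * \<rho> x y" if "x \<in> A" "y \<in> A" for x y
  proof (cases "x = y")
    case True then show ?thesis using refl that by simp
  next
    case False
    have "ratio (x, y) \<le> L" unfolding L_def using fin that by (intro Max_ge) auto
    then show ?thesis using pos[OF that False] by (simp add: ratio_def divide_le_eq)
  qed
  have "L \<le> L'" if "L' \<ge> 0" "\<forall>x\<in>A. \<forall>y\<in>A. norm (g x - g y) \<le> L' * \<rho> x y" for L'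
  proof -
    have "ratio (x, y) \<le> L'" if xy: "x \<in> A" "y \<in> A" for x y
      using \<open>\<forall>x\<in>A. _\<close> xy pos[OF xy] refl \<open>L' \<ge> 0\<close>
      by (cases "x = y") (auto simp: ratio_def divide_le_eq)
    then show ?thesis unfolding L_def using fin \<open>L' \<ge> 0\<close> by (subst Max_le_iff) auto
  qed
  then have "Lip \<rho> A g = ennreal L"
    unfolding Lip_def using \<open>L \<ge> 0\<close> adm
    by (intro antisym Inf_lower Inf_greatest) (auto intro!: ennreal_leI)
  then show ?thesis using that \<open>L \<ge> 0\<close> adm by blast
qed

lemma Lip_le:
  assumes "L \<ge> 0" "\<And>x y. x \<in> A \<Longrightarrow> y \<in> A \<Longrightarrow> norm (g x - g y) \<le> L * \<rho> x y"
  shows "Lip \<rho> A g \<le> ennreal L"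
  unfolding Lip_def using assms by (intro Inf_lower) auto

text \<open>
  Applied to \<open>t \<mapsto> F (sqrt t)\<close>, this shows that the supremum in the extension theorem is at most
  \<open>m + 1\<close>, hence finite; otherwise the product with the Lipschitz constant of \<open>f\<close> could be
  \<open>\<infinity> * 0\<close>, which is 0.
\<close>

lemma concave_on_dilate_le:
  fixes G :: "real \<Rightarrow> real"
  assumes "concave_on {0..} G" "G 0 \<ge> 0" "t \<ge> 0" "c \<ge> 1"
  shows "G (c * t) \<le> c * G t"
proof -
  have "(1 - 1 / c) * G 0 + (1 / c) * G (c * t) \<le> G ((1 - 1 / c) *\<^sub>R 0 + (1 / c) *\<^sub>R (c * t))"
    using assms by (intro concave_onD[of "{0..}"]) auto
  moreover have "(1 - 1 / c) * G 0 \<ge> 0" using assms by simp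
  ultimately have "G (c * t) / c \<le> G t" using assms(4) by simp
  then show ?thesis using assms(4) by (simp add: divide_le_eq mult.commute)
qed

theorem theorem1p3:
  fixes F :: "real \<Rightarrow> real"
    and X S :: "'h::{real_inner, complete_space} set"
    and f :: "'h \<Rightarrow> 'e::banach"
  assumes F_nonneg: "F \<in> {0..} \<rightarrow> {0..}"
    and F_zero: "F 0 = 0"
    and F_sqrt_strict_mono: "strict_mono_on {0..} (\<lambda>t. F (sqrt t))"
    and F_sqrt_concave: "concave_on {0..} (\<lambda>t. F (sqrt t))"
    and finite_X: "finite X"
    and S_subset: "S \<subseteq> X"
    and S_nonempty: "S \<noteq> {}"
  shows "\<exists>f' \<in> X \<rightarrow> closure (convex hull (f ` S)).
    (\<forall>x\<in>S. f' x = f x) \<and>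
    is_Lipschitz (F_transform_dist F) X f' \<and>
    Lip (F_transform_dist F) X f' \<le>
      (SUP x\<in>{0<..}. ennreal (F (sqrt (real (card (X - S)) + 1) * x) / F x)) *
      Lip (F_transform_dist F) S f"
proof -
  define M where "M = real (card (X - S)) + 1"
  define D where "D = (SUP x\<in>{0<..}. ennreal (F (sqrt M * x) / F x))"
  define G where "G = (\<lambda>t. F (sqrt t))"
  have M: "M \<ge> 1" by (simp add: M_def)
  have FG: "F x = G (x\<^sup>2)" if "x \<ge> 0" for x using that by (simp add: G_def)
  have G_less: "G s < G t" if "0 \<le> s" "s < t" for s t
    using strict_mono_onD[OF F_sqrt_strict_mono, of s t] that by (simp add: G_def)
  have G_le: "G s \<le> G t" if "0 \<le> s" "s \<le> t" for s t
    using G_less[of s t] that by (cases "s = t") auto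
  have conc: "concave_on {0..} G" using F_sqrt_concave by (simp add: G_def)
  have G0: "G 0 = 0" by (simp add: G_def F_zero)
  have Fpos: "F x > 0" if "x > 0" for x using G_less[of 0 "x\<^sup>2"] that by (simp add: FG G0)
  have "D \<le> ennreal M"
    unfolding D_def
  proof (rule SUP_least, rule ennreal_leI)
    fix x :: real assume "x \<in> {0<..}"
    then show "F (sqrt M * x) / F x \<le> M"
      using concave_on_dilate_le[OF conc, of "x\<^sup>2" M] G0 M Fpos[of x]
      by (simp add: FG power_mult_distrib divide_le_eq)
  qed
  then obtain d where d: "D = ennreal d" "d \<ge> 0"
    by (metis ennreal_cases ennreal_less_top leD)
  have FM: "F (sqrt M * x) \<le> d * F x" if "x \<ge> 0" for x
  proof (cases "x = 0")
    case True then show ?thesis by (simp add: F_zero)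
  next
    case False
    then have "ennreal (F (sqrt M * x) / F x) \<le> D"
      unfolding D_def using that by (intro SUP_upper) auto
    then have "F (sqrt M * x) / F x \<le> d" using d by (simp add: ennreal_le_iff)
    then show ?thesis using Fpos[of x] that False by (simp add: divide_le_eq)
  qed
  obtain L where L: "L \<ge> 0" "\<And>x y. x \<in> S \<Longrightarrow> y \<in> S \<Longrightarrow> norm (f x - f y) \<le> L * F_transform_dist F x y"
    "Lip (F_transform_dist F) S f = ennreal L"
    by (rule finite_Lip_attained[of S "F_transform_dist F" f])
      (use finite_subset[OF S_subset finite_X] in \<open>auto simp: F_transform_dist_def F_zero Fpos\<close>)
  obtain \<R> :: "('h \<Rightarrow> 'h) set" and p :: "('h \<Rightarrow> 'h) \<Rightarrow> real"
    where R: "finite \<R>" "\<And>r. r \<in> \<R> \<Longrightarrow> p r \<ge> 0" "sum p \<R> = 1"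
      "\<And>r x. r \<in> \<R> \<Longrightarrow> x \<in> X \<Longrightarrow> r x \<in> S" "\<And>r x. r \<in> \<R> \<Longrightarrow> x \<in> S \<Longrightarrow> r x = x"
    and var: "\<And>x y. x \<in> X \<Longrightarrow> y \<in> X \<Longrightarrow>
      (\<Sum>r\<in>\<R>. p r * (norm (r x - r y))\<^sup>2) \<le> M * (norm (x - y))\<^sup>2"
    by (rule random_retraction[OF finite_X S_subset S_nonempty, folded M_def]) (rule that)
  have R_ne: "\<R> \<noteq> {}" using R(3) by auto
  define f' where "f' = (\<lambda>x. \<Sum>r\<in>\<R>. p r *\<^sub>R f (r x))"
  have "f' x \<in> convex hull (f ` S)" if "x \<in> X" for x
    unfolding f'_def using R that by (intro convex_sum) (auto intro: hull_inc)
  then have f'_mem: "f' \<in> X \<rightarrow> closure (convex hull (f ` S))" using closure_subset by fastforce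
  have f'_ext: "f' x = f x" if "x \<in> S" for x
  proof -
    have "f' x = (\<Sum>r\<in>\<R>. p r *\<^sub>R f x)"
      unfolding f'_def by (rule sum.cong) (metis R(5) that)+
    then show ?thesis using R(3) by (simp add: scaleR_sum_left[symmetric])
  qed
  have Jensen: "(\<Sum>r\<in>\<R>. p r * F (norm (r x - r y))) \<le> F (sqrt M * norm (x - y))"
    if "x \<in> X" "y \<in> X" for x y
  proof -
    have "(\<Sum>r\<in>\<R>. p r * F (norm (r x - r y))) = (\<Sum>r\<in>\<R>. p r * G ((norm (r x - r y))\<^sup>2))"
      by (simp add: FG)
    also have "\<dots> \<le> G (\<Sum>r\<in>\<R>. p r *\<^sub>R (norm (r x - r y))\<^sup>2)"
      using R R_ne by (intro concave_on_sum[OF _ _ conc]) auto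
    also have "\<dots> \<le> G (M * (norm (x - y))\<^sup>2)"
      using var[OF that] R(2) by (intro G_le) (auto intro!: sum_nonneg)
    also have "\<dots> = F (sqrt M * norm (x - y))"
      using M by (simp add: FG power_mult_distrib)
    finally show ?thesis .
  qed
  have Lip_bound: "norm (f' x - f' y) \<le> d * L * F_transform_dist F x y" if "x \<in> X" "y \<in> X" for x y
  proof -
    have "norm (f' x - f' y) = norm (\<Sum>r\<in>\<R>. p r *\<^sub>R (f (r x) - f (r y)))"
      by (simp add: f'_def sum_subtractf scaleR_diff_right)
    also have "\<dots> \<le> (\<Sum>r\<in>\<R>. p r * (L * F (norm (r x - r y))))"
      using R that L(2) by (intro sum_norm_le) (auto simp: F_transform_dist_def intro!: mult_left_mono)
    also have "\<dots> = L * (\<Sum>r\<in>\<R>. p r * F (norm (r x - r y)))"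
      by (simp add: sum_distrib_left mult_ac)
    also have "\<dots> \<le> L * (d * F (norm (x - y)))"
      using Jensen[OF that] FM[of "norm (x - y)"] L(1) by (intro mult_left_mono) auto
    finally show ?thesis by (simp add: F_transform_dist_def mult_ac)
  qed
  have "Lip (F_transform_dist F) X f' \<le> ennreal (d * L)"
    by (rule Lip_le) (use Lip_bound d L(1) in auto)
  moreover have "ennreal (d * L) = D * Lip (F_transform_dist F) S f"
    using d L by (simp add: ennreal_mult)
  moreover have "is_Lipschitz (F_transform_dist F) X f'"
    unfolding is_Lipschitz_def using calculation(1) by (simp add: le_less_trans)
  ultimately show ?thesis
    using f'_mem f'_ext unfolding D_def M_def by auto
qed

end
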